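(* Let $E$ be a Euclidean space, $U\subset E$, $T:U\rightrightarrows U$ with a chosen selection $x\mapsto x^+\in Tx$, and let $V:U\to\mathbb{R}_+$ be a smooth Lyapunov function with respect to $(\omega_1,\omega_2)$ on $U$ for the difference inclusion $x^+\in Tx$, satisfying $\langle\nabla V(x^+),x-x^+\rangle=0$ for all $x\in U$. Let $\Omega_T\in\mathbf{MCS}(V)$, with associated maps $\Lambda,\psi$. For given $x$ let $Q:u\mapsto d(u,\Omega_Tx)^2=\|u-\Omega_Tx\|^2$. Then whenever $x,\,2x^+-x,\,\Lambda x$ are not colinear: (i) $P_{\operatorname{aff}\{x,2x^+-x,\Lambda x\}-x}\big(\nabla V(x^+)\big)\in\operatorname{span}\{\nabla Q(x^+)\}$; and (ii) $P_{\operatorname{aff}\{x,2x^+-x,\Lambda x\}-x}\big(\nabla V(\psi x)\big)\in\operatorname{span}\{\nabla Q(\psi x)\}$. Accordingly, $\mathbf{MCS}(V)\subset\mathbf{MSS}(V)_2^2$, with $\Gamma_1:x\mapsto 2x^+-x$, $\Gamma_2:x\mapsto\Lambda x$, $\sigma_1:x\mapsto x^+$ and $\sigma_2:x\mapsto\psi x$.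
   Context: $P_S$ is the orthogonal projection onto $S$. For $y,z\in E$, $H(y,z):=\frac{y+z}{2}+\{y-z\}^\perp$. $C(a,b,c)$ is the circumcenter of non-colinear points $a,b,c$: the unique point of $\operatorname{aff}\{a,b,c\}$ equidistant from $a,b,c$. Lyapunov function: for continuous $\omega_1,\omega_2:E\to\mathbb{R}_+$, $V:U\to\mathbb{R}_+$ is a Lyapunov function with respect to $(\omega_1,\omega_2)$ on $U$ for $x^+\in Tx$ if there are continuous, zero-at-zero, monotone increasing, unbounded $\alpha_1,\alpha_2:\mathbb{R}_+\to\mathbb{R}_+$ such that for all $x\in U$: $\alpha_1(\omega_1(x))\le V(x)\le\alpha_2(\omega_2(x))$; $\sup_{x^+\in Tx}V(x^+)\le V(x)e^{-1}$; and $V(x)=0\iff x\in\mathcal{A}$, where $\mathcal{A}$ is the set of $\xi\in U$ such that $\omega_1(\varphi(k))=0$ for every $k\in\mathbb{N}$ and every sequence $\varphi$ with $\varphi(0)=\xi$ and $\varphi(j+1)\in T(\varphi(j))$ for all $j$. $\mathbf{MCS}(V)$ ("minimizes a circumcenter-defined spherical surrogate for $V$"): $\Omega_T\in\mathbf{MCS}(V)$ if there are maps $\Lambda,\psi$ such that for all $x\in U$ $$\Omega_Tx=\begin{cases}C(x,2x^+-x,\Lambda x)&\text{if }x,2x^+-x,\Lambda x\text{ are not colinear},\\ x^+&\text{otherwise},\end{cases}$$ $\psi x\in H(x,\Lambda x)\cap\operatorname{aff}\{x,2x^+-x,\Lambda x\}$, $\;x^++\mathbb{R}\nabla V(x^+)\subset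 H(x,2x^+-x)$, and $\psi x+\mathbb{R}\nabla V(\psi x)\subset H(\Lambda x,x)$ (with $\psi x\in U$). $\mathbf{MSS}(V)_m^n$ ("minimizes an $n$-dimensional spherical surrogate for $V$, fitted at $m$ points"): $\Theta_T\in\mathbf{MSS}(V)_m^n$ if there are maps $\sigma_1,\dots,\sigma_m,\Gamma_1,\dots,\Gamma_n$ such that whenever $\operatorname{aff}\{x,\Gamma_1x,\dots,\Gamma_nx\}$ has dimension $n$, the function $Q:u\mapsto d(u,\Theta_Tx)^2$ satisfies, for all $j\in\{1,\dots,m\}$, $P_{\operatorname{aff}\{x,\Gamma_1x,\dots,\Gamma_nx\}-x}(\nabla V(\sigma_jx))\in\operatorname{span}\{\nabla Q(\sigma_jx)\}$.
   Formalization: (i) is proved assuming ∇V(x⁺)=0 if Ω_T x=x⁺, (ii) assuming ∇V(ψx)=0 if Ω_T x=ψx, and the inclusion with the named Γ, σ assuming both at every non-colinear x, since ∇Q vanishes at the circumcenter and the claim can fail there; MCS(V)⊂MSS(V)_2^2 itself is proved without these conditions. *)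

theory Defs
  imports "HOL-Analysis.Analysis"
begin

definition gradient :: "('a::euclidean_space \<Rightarrow> real) \<Rightarrow> 'a \<Rightarrow> 'a" where
  "gradient f x = (THE D. GDERIV f x :> D)"

text \<open>
  A function on an arbitrary set \<open>U\<close> is represented by a total function that is \<open>C\<^sup>1\<close> on
  an open neighbourhood of \<open>U\<close>, so that gradients at points of \<open>U\<close> are well defined.
\<close>

definition smooth_near :: "'a::euclidean_space set \<Rightarrow> ('a \<Rightarrow> real) \<Rightarrow> bool" where
  "smooth_near U f \<longleftrightarrow>
     (\<exists>W. open W \<and> U \<subseteq> W \<and> (\<forall>x\<in>W. f differentiable (at x)) \<and> continuous_on W (gradient f))"

definition bisector :: "'a::euclidean_space \<Rightarrow> 'a \<Rightarrow> 'a set" where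
  "bisector y z = (\<lambda>w. (1/2) *\<^sub>R (y + z) + w) ` orthogonal_comp {y - z}"

definition circumcenter :: "'a::euclidean_space \<Rightarrow> 'a \<Rightarrow> 'a \<Rightarrow> 'a" where
  "circumcenter a b c =
     (THE p. p \<in> affine hull {a, b, c} \<and> dist p a = dist p b \<and> dist p b = dist p c)"

definition line_along :: "'a::euclidean_space \<Rightarrow> 'a \<Rightarrow> 'a set" where
  "line_along p v = range (\<lambda>t::real. p + t *\<^sub>R v)"

definition direction_space :: "'a::euclidean_space set \<Rightarrow> 'a \<Rightarrow> 'a set" where
  "direction_space S x = (\<lambda>a. a - x) ` (affine hull S)"

text \<open>
  The gauges \<open>\<alpha>\<^sub>1, \<alpha>\<^sub>2\<close> are required to be monotone in the weak sense only.
\<close>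

definition gauge_fun :: "(real \<Rightarrow> real) \<Rightarrow> bool" where
  "gauge_fun \<alpha> \<longleftrightarrow> continuous_on {0..} \<alpha> \<and> \<alpha> 0 = 0 \<and> mono_on {0..} \<alpha> \<and>
     \<not> bdd_above (\<alpha> ` {0..})"

definition attractor :: "'a set \<Rightarrow> ('a \<Rightarrow> 'a set) \<Rightarrow> ('a \<Rightarrow> real) \<Rightarrow> 'a set" where
  "attractor U T \<omega> = {\<xi> \<in> U. \<forall>\<phi>::nat \<Rightarrow> 'a.
     \<phi> 0 = \<xi> \<and> (\<forall>j. \<phi> (Suc j) \<in> T (\<phi> j)) \<longrightarrow> (\<forall>k. \<omega> (\<phi> k) = 0)}"

text \<open>
  Boundedness of \<open>V\<close> on \<open>T x\<close> is stated because a real supremum carries no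
  information otherwise.
\<close>

definition lyapunov_function ::
  "'a::euclidean_space set \<Rightarrow> ('a \<Rightarrow> 'a set) \<Rightarrow> ('a \<Rightarrow> real) \<Rightarrow> ('a \<Rightarrow> real) \<Rightarrow> ('a \<Rightarrow> real) \<Rightarrow> bool"
where
  "lyapunov_function U T \<omega>1 \<omega>2 V \<longleftrightarrow>
     continuous_on UNIV \<omega>1 \<and> (\<forall>x. 0 \<le> \<omega>1 x) \<and>
     continuous_on UNIV \<omega>2 \<and> (\<forall>x. 0 \<le> \<omega>2 x) \<and>
     (\<forall>x\<in>U. 0 \<le> V x) \<and>
     (\<exists>\<alpha>1 \<alpha>2. gauge_fun \<alpha>1 \<and> gauge_fun \<alpha>2 \<and>
        (\<forall>x\<in>U. \<alpha>1 (\<omega>1 x) \<le> V x \<and> V x \<le> \<alpha>2 (\<omega>2 x))) \<and>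
     (\<forall>x\<in>U. bdd_above (V ` T x) \<and> (SUP y\<in>T x. V y) \<le> V x * exp (- 1)) \<and>
     (\<forall>x\<in>U. V x = 0 \<longleftrightarrow> x \<in> attractor U T \<omega>1)"

text \<open>
  In the following, \<open>s\<close> is the selection \<open>x \<mapsto> x\<^sup>+\<close>. The predicates \<open>MCS_with\<close> and
  \<open>MSS_with\<close> name the auxiliary maps that the classes \<open>MCS\<close> and \<open>MSS\<close> quantify
  existentially; membership constrains an operator on \<open>U\<close> only.
\<close>

definition MCS_with ::
  "'a::euclidean_space set \<Rightarrow> ('a \<Rightarrow> 'a) \<Rightarrow> ('a \<Rightarrow> real) \<Rightarrow> ('a \<Rightarrow> 'a) \<Rightarrow> ('a \<Rightarrow> 'a) \<Rightarrow> ('a \<Rightarrow> 'a) \<Rightarrow> bool"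
where
  "MCS_with U s V \<Omega> \<Lambda> \<psi> \<longleftrightarrow> (\<forall>x\<in>U.
     \<Omega> x = (if \<not> collinear {x, 2 *\<^sub>R s x - x, \<Lambda> x}
            then circumcenter x (2 *\<^sub>R s x - x) (\<Lambda> x) else s x) \<and>
     \<psi> x \<in> U \<and>
     \<psi> x \<in> bisector x (\<Lambda> x) \<inter> affine hull {x, 2 *\<^sub>R s x - x, \<Lambda> x} \<and>
     line_along (s x) (gradient V (s x)) \<subseteq> bisector x (2 *\<^sub>R s x - x) \<and>
     line_along (\<psi> x) (gradient V (\<psi> x)) \<subseteq> bisector (\<Lambda> x) x)"

definition MCS :: "'a::euclidean_space set \<Rightarrow> ('a \<Rightarrow> 'a) \<Rightarrow> ('a \<Rightarrow> real) \<Rightarrow> ('a \<Rightarrow> 'a) set" where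
  "MCS U s V = {\<Omega>. \<exists>\<Lambda> \<psi>. MCS_with U s V \<Omega> \<Lambda> \<psi>}"

text \<open>
  The gradient of \<open>Q\<close> vanishes at the centre \<open>\<Theta> x\<close>, so a fitted point \<open>\<sigma> j x = \<Theta> x\<close>
  satisfies the span condition only if the projected gradient of \<open>V\<close> is zero there.
  \<open>MCS_with\<close> does not exclude this: for \<open>V(a,b) = a\<^sup>2 + 2b\<^sup>2\<close>, \<open>x = (3,0)\<close>, \<open>x\<^sup>+ = (1,1)\<close>,
  \<open>\<Lambda> x = (0,3)\<close>, \<open>\<psi> x = 0\<close> one gets \<open>\<Omega> x = x\<^sup>+\<close> with \<open>\<nabla>V(x\<^sup>+) = (2,4)\<close>.
\<close>

definition MSS_with ::
  "'a::euclidean_space set \<Rightarrow> ('a \<Rightarrow> real) \<Rightarrow> nat \<Rightarrow> nat \<Rightarrow> ('a \<Rightarrow> 'a)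
     \<Rightarrow> (nat \<Rightarrow> 'a \<Rightarrow> 'a) \<Rightarrow> (nat \<Rightarrow> 'a \<Rightarrow> 'a) \<Rightarrow> bool"
where
  "MSS_with U V m n \<Theta> \<sigma> \<Gamma> \<longleftrightarrow> (\<forall>x\<in>U.
     (\<forall>j\<in>{1..m}. \<sigma> j x \<in> U) \<and>
     (let S = insert x ((\<lambda>i. \<Gamma> i x) ` {1..n}); Q = (\<lambda>u. (dist u (\<Theta> x))\<^sup>2)
      in aff_dim (affine hull S) = int n \<longrightarrow>
         (\<forall>j\<in>{1..m}. closest_point (direction_space S x) (gradient V (\<sigma> j x))
                        \<in> span {gradient Q (\<sigma> j x)})))"

definition MSS ::
  "'a::euclidean_space set \<Rightarrow> ('a \<Rightarrow> real) \<Rightarrow> nat \<Rightarrow> nat \<Rightarrow> ('a \<Rightarrow> 'a) set"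
where
  "MSS U V m n = {\<Theta>. \<exists>\<sigma> \<Gamma>. MSS_with U V m n \<Theta> \<sigma> \<Gamma>}"

end

theory Submission
  imports Defs
begin

text \<open>
  Let \<open>D\<close> be the direction plane of \<open>aff {a, b, c}\<close>. If the line through \<open>p\<close> along \<open>g\<close> lies in
  the bisector of \<open>a\<close> and \<open>d \<in> {b, c}\<close>, then \<open>g\<close>, hence also its projection to \<open>D\<close>, is
  orthogonal to \<open>a - d\<close>. For \<open>p\<close> in the plane the vector from \<open>p\<close> to the circumcenter lies in \<open>D\<close>
  and is orthogonal to \<open>a - d\<close> too, since both points are equidistant from \<open>a\<close> and \<open>d\<close>. As
  \<open>D\<close> has dimension two, the two vectors are parallel as soon as the latter is nonzero, and it is
  proportional to the gradient of the squared distance to the circumcenter.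

  For the inclusion of classes the points where that gradient vanishes must be avoided. If just one
  of \<open>x\<^sup>+\<close> and \<open>\<psi> x\<close> is the circumcenter, the surrogate is fitted twice at the other point;
  if both are, then \<open>\<nabla>V\<close> is orthogonal to \<open>D\<close> there and its projection is zero.
\<close>

section \<open>Squared distances, equidistance and perpendicular bisectors\<close>

lemma gradient_dist_square:
  "gradient (\<lambda>u. (dist u c)\<^sup>2) p = 2 *\<^sub>R (p - c)"
  unfolding gradient_def
proof (rule the_equality)
  show *: "GDERIV (\<lambda>u. (dist u c)\<^sup>2) p :> 2 *\<^sub>R (p - c)"
    unfolding gderiv_def dist_norm power2_norm_eq_inner
    by (auto intro!: derivative_eq_intros simp: inner_commute algebra_simps)
  \<comment> \<open>\<open>gradient\<close> is a definite description, so uniqueness is due as well: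
    two candidates have the same inner product with every \<open>h\<close>.\<close>
  show "D = 2 *\<^sub>R (p - c)" if "GDERIV (\<lambda>u. (dist u c)\<^sup>2) p :> D" for D
  proof -
    have "(\<lambda>h. h \<bullet> D) = (\<lambda>h. h \<bullet> (2 *\<^sub>R (p - c)))"
      using that * has_derivative_unique unfolding gderiv_def by blast
    then show ?thesis
      by (simp only: fun_eq_iff vector_eq_ldot)
  qed
qed

text \<open>Expanding the squared norms cancels the quadratic term in \<open>y\<close>. Equidistance
  becomes a linear equation in \<open>y - a\<close> whose right-hand side does not involve
  \<open>y\<close>.\<close>

lemma dist_eq_iff_inner:
  fixes y a b :: "'a::real_inner"
  shows "dist y a = dist y b \<longleftrightarrow> 2 * ((y - a) \<bullet> (b - a)) = (b - a) \<bullet> (b - a)"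
proof -
  have "dist y a = dist y b \<longleftrightarrow> (dist y a)\<^sup>2 = (dist y b)\<^sup>2"
    by simp
  also have "\<dots> \<longleftrightarrow> 2 * ((y - a) \<bullet> (b - a)) = (b - a) \<bullet> (b - a)"
    unfolding dist_norm power2_norm_eq_inner
    by (auto simp: algebra_simps inner_commute)
  finally show ?thesis .
qed

text \<open>Both sides say that the vector from the midpoint to \<open>y\<close> is orthogonal to
  \<open>b - a\<close>. Later arguments use only the equidistance form.\<close>

lemma bisector_eq: "bisector a b = {y. dist y a = dist y b}"
proof -
  have "y \<in> bisector a b \<longleftrightarrow> (y - (1/2) *\<^sub>R (a + b)) \<bullet> (b - a) = 0" for y
  proof
    assume "y \<in> bisector a b"
    then show "(y - (1/2) *\<^sub>R (a + b)) \<bullet> (b - a) = 0"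
      by (auto simp: bisector_def orthogonal_comp_def orthogonal_def algebra_simps inner_commute)
  next
    assume "(y - (1/2) *\<^sub>R (a + b)) \<bullet> (b - a) = 0"
    then have "y - (1/2) *\<^sub>R (a + b) \<in> orthogonal_comp {a - b}"
      by (auto simp: orthogonal_comp_def orthogonal_def algebra_simps inner_commute)
    then show "y \<in> bisector a b"
      unfolding bisector_def by (rule rev_image_eqI) simp
  qed
  moreover have "(y - (1/2) *\<^sub>R (a + b)) \<bullet> (b - a) = 0 \<longleftrightarrow> dist y a = dist y b" for y
    unfolding dist_eq_iff_inner by (auto simp: algebra_simps inner_commute)
  ultimately show ?thesis
    by blast
qed

lemma bisector_commute: "bisector a b = bisector b a"
  by (auto simp: bisector_eq)

text \<open>Two points of the line suffice: \<open>t = 0\<close> gives \<open>p\<close> itself, and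
  subtracting its equation from that of \<open>t = 1\<close> leaves the direction
  \<open>v\<close>.\<close>

lemma line_along_subset_bisector:
  assumes "line_along p v \<subseteq> bisector a b"
  shows "dist p a = dist p b" and "v \<bullet> (b - a) = 0"
proof -
  have *: "dist (p + t *\<^sub>R v) a = dist (p + t *\<^sub>R v) b" for t
    using assms by (auto simp: line_along_def bisector_eq)
  from *[of 0] show p: "dist p a = dist p b"
    by simp
  from p *[of 1] show "v \<bullet> (b - a) = 0"
    unfolding dist_eq_iff_inner by (simp add: algebra_simps)
qed

section \<open>The plane through three points and its circumcenter\<close>

lemma affine_hull_3_span:
  fixes a b c :: "'a::real_vector"
  shows "affine hull {a, b, c} = (+) a ` span {b - a, c - a}"
  using affine_hull_insert_span_gen[of a "{b, c}"] by simp

lemma direction_space_3: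
  "direction_space {a, b, c} a = span {b - a, c - a}"
  by (simp add: direction_space_def affine_hull_3_span image_image)

lemma orthogonal_span_pair_eq_0:
  fixes w :: "'a::real_inner"
  assumes "w \<in> span {u, v}" and "w \<bullet> u = 0" and "w \<bullet> v = 0"
  shows "w = 0"
proof -
  have "orthogonal w w"
    using assms by (intro orthogonal_to_span[of w "{u, v}"]) (auto simp: orthogonal_def)
  then show ?thesis
    by (simp add: orthogonal_def)
qed

text \<open>With \<open>a\<close> as origin, the circumcenter solves a linear 2x2 system in the
  plane. Its Gram determinant \<open>d\<close> is nonzero by the equality case of
  Cauchy-Schwarz.\<close>

lemma circumcenter_exists:
  fixes a b c :: "'a::real_inner"
  assumes "\<not> collinear {a, b, c}"
  shows "\<exists>p \<in> affine hull {a, b, c}. dist p a = dist p b \<and> dist p b = dist p c"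
proof -
  define u v where "u = b - a" and "v = c - a"
  have "\<not> collinear {0, u, v}"
    using assms collinear_3[of b a c] by (simp add: u_def v_def insert_commute)
  then have "\<bar>u \<bullet> v\<bar> \<noteq> norm u * norm v"
    by (simp add: norm_cauchy_schwarz_equal)
  then have "\<bar>u \<bullet> v\<bar>\<^sup>2 \<noteq> (norm u * norm v)\<^sup>2"
    by (metis abs_ge_zero mult_nonneg_nonneg norm_ge_zero power2_eq_imp_eq)
  then have "(u \<bullet> v)\<^sup>2 \<noteq> (u \<bullet> u) * (v \<bullet> v)"
    by (simp add: power_mult_distrib power2_norm_eq_inner)
  define d where "d = (u \<bullet> u) * (v \<bullet> v) - (u \<bullet> v)\<^sup>2"
  have "d \<noteq> 0"
    using \<open>(u \<bullet> v)\<^sup>2 \<noteq> _\<close> by (simp add: d_def)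
  \<comment> \<open>Cramer's rule for \<open>2 w \<bullet> u = u \<bullet> u\<close> and \<open>2 w \<bullet> v = v \<bullet> v\<close> with \<open>w \<in> span {u, v}\<close>.\<close>
  define w where "w = (1 / (2 * d)) *\<^sub>R (((u \<bullet> u) * (v \<bullet> v) - (v \<bullet> v) * (u \<bullet> v)) *\<^sub>R u +
    ((u \<bullet> u) * (v \<bullet> v) - (u \<bullet> u) * (u \<bullet> v)) *\<^sub>R v)"
  have "d * (2 * (w \<bullet> u)) = d * (u \<bullet> u)" and "d * (2 * (w \<bullet> v)) = d * (v \<bullet> v)"
    using \<open>d \<noteq> 0\<close> by (simp_all add: w_def inner_add_left inner_commute[of v u])
      (simp_all add: d_def power2_eq_square algebra_simps)
  then have "2 * (w \<bullet> u) = u \<bullet> u" and "2 * (w \<bullet> v) = v \<bullet> v"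
    using \<open>d \<noteq> 0\<close> by simp_all
  then have "dist (a + w) a = dist (a + w) b" and "dist (a + w) a = dist (a + w) c"
    unfolding dist_eq_iff_inner by (simp_all add: u_def v_def)
  moreover have "w \<in> span {u, v}"
    unfolding w_def by (intro span_add span_scale span_base) auto
  then have "a + w \<in> affine hull {a, b, c}"
    by (simp add: affine_hull_3_span u_def v_def)
  ultimately show ?thesis
    by (intro bexI[of _ "a + w"]) auto
qed

lemma affine_hull_3_diff_mem_span:
  fixes p q a b c :: "'a::real_vector"
  assumes "p \<in> affine hull {a, b, c}" and "q \<in> affine hull {a, b, c}"
  shows "p - q \<in> span {b - a, c - a}"
proof -
  from assms obtain p' q' where "p = a + p'" "q = a + q'"
    "p' \<in> span {b - a, c - a}" "q' \<in> span {b - a, c - a}"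
    by (auto simp: affine_hull_3_span)
  then show ?thesis
    by (simp add: span_diff)
qed

lemma equidistant_diff_orthogonal:
  fixes p q a b :: "'a::real_inner"
  assumes "dist p a = dist p b" and "dist q a = dist q b"
  shows "(p - q) \<bullet> (b - a) = 0"
  using assms unfolding dist_eq_iff_inner by (simp add: inner_diff_left)

text \<open>The description is unique: the difference of two candidates lies in the direction plane
  and is orthogonal to both of its generators.\<close>

lemma circumcenter_properties:
  fixes a b c :: "'a::euclidean_space"
  assumes "\<not> collinear {a, b, c}"
  shows "circumcenter a b c \<in> affine hull {a, b, c}"
    and "dist (circumcenter a b c) a = dist (circumcenter a b c) b"
    and "dist (circumcenter a b c) a = dist (circumcenter a b c) c"
proof -
  let ?P = "\<lambda>p. p \<in> affine hull {a, b, c} \<and> dist p a = dist p b \<and> dist p b = dist p c"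
  have "p = q" if "?P p" "?P q" for p q
  proof -
    have "p - q = 0"
      using that affine_hull_3_diff_mem_span[of p a b c q]
        equidistant_diff_orthogonal[of p a b q] equidistant_diff_orthogonal[of p a c q]
      by (intro orthogonal_span_pair_eq_0[of "p - q" "b - a" "c - a"]) auto
    then show ?thesis
      by simp
  qed
  then have "\<exists>!p. ?P p"
    using circumcenter_exists[OF assms] by blast
  then have "?P (circumcenter a b c)"
    unfolding circumcenter_def by (rule theI')
  then show "circumcenter a b c \<in> affine hull {a, b, c}"
    and "dist (circumcenter a b c) a = dist (circumcenter a b c) b"
    and "dist (circumcenter a b c) a = dist (circumcenter a b c) c"
    by auto
qed

section \<open>Orthogonal projection and parallel vectors in a plane\<close>

lemma closest_point_subspace:
  fixes S :: "'a::euclidean_space set"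
  assumes "subspace S"
  shows "closest_point S g \<in> S"
    and "w \<in> S \<Longrightarrow> (g - closest_point S g) \<bullet> w = 0"
proof -
  have S: "closed S" "convex S" "S \<noteq> {}"
    using assms by (auto simp: closed_subspace subspace_imp_convex dest: subspace_0)
  then show in_S: "closest_point S g \<in> S"
    by (simp add: closest_point_in_set)
  assume "w \<in> S"
  \<comment> \<open>Testing the variational inequality of the projection on both sides of the
    closest point yields both signs, hence equality.\<close>
  then have "closest_point S g + w \<in> S" "closest_point S g - w \<in> S"
    using in_S assms by (auto simp: subspace_add subspace_diff)
  then show "(g - closest_point S g) \<bullet> w = 0"
    using closest_point_dot[OF S(2,1), of "closest_point S g + w" g]
      closest_point_dot[OF S(2,1), of "closest_point S g - w" g] by simp
qed

text \<open>The orthogonal nonzero vectors \<open>w\<close> and \<open>e\<close> span the plane.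
  Removing from \<open>z\<close> its component along \<open>w\<close> leaves a vector orthogonal to
  both, which is zero.\<close>

lemma orthogonal_in_plane_parallel:
  fixes u v w z e :: "'a::euclidean_space"
  assumes w: "w \<in> span {u, v}" "w \<noteq> 0" "w \<bullet> e = 0"
    and z: "z \<in> span {u, v}" "z \<bullet> e = 0"
    and e: "e \<in> span {u, v}" "e \<noteq> 0"
  shows "z \<in> span {w}"
proof -
  have "independent {w, e}"
    using w e by (intro pairwise_orthogonal_independent)
      (auto simp: pairwise_def orthogonal_def inner_commute)
  moreover have "w \<noteq> e"
    using w by auto
  ultimately have "dim (span {w, e}) = 2"
    by (simp add: dim_eq_card_independent)
  \<comment> \<open>An upper bound suffices, since \<open>span {w, e}\<close> is contained in
    \<open>span {u, v}\<close> and has dimension 2.\<close>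
  moreover have "dim (span {u, v}) \<le> 2"
    using dim_le_card'[of "{u, v}"] card_insert_le_m1[of 2 "{v}" u] by simp
  ultimately have "span {w, e} = span {u, v}"
    using w e by (intro subspace_dim_equal) (auto simp: span_minimal)
  define r where "r = z - ((z \<bullet> w) / (w \<bullet> w)) *\<^sub>R w"
  have "r = 0"
  proof (rule orthogonal_span_pair_eq_0)
    show "r \<in> span {w, e}"
      unfolding r_def \<open>span {w, e} = _\<close> using w z by (intro span_diff span_scale)
    show "r \<bullet> w = 0" "r \<bullet> e = 0"
      using w z by (simp_all add: r_def inner_diff_left)
  qed
  then have "z = ((z \<bullet> w) / (w \<bullet> w)) *\<^sub>R w"
    by (simp add: r_def)
  then show ?thesis
    by (metis insertI1 span_base span_scale)
qed

text \<open>The parameter \<open>d\<close> serves both fitted points: \<open>d = b\<close> for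
  \<open>s x\<close> and \<open>d = c\<close> for \<open>\<psi> x\<close>. Assumption
  \<open>nd\<close> covers \<open>p\<close> at the circumcenter, where the span on the right is
  zero.\<close>

lemma projected_gradient_mem_span:
  fixes a b c d p g :: "'a::euclidean_space"
  assumes nc: "\<not> collinear {a, b, c}"
    and p: "p \<in> affine hull {a, b, c}"
    and d: "d \<in> {b, c}"
    and line: "line_along p g \<subseteq> bisector a d"
    and nd: "circumcenter a b c = p \<Longrightarrow> g = 0"
  shows "closest_point (direction_space {a, b, c} a) g
    \<in> span {gradient (\<lambda>u. (dist u (circumcenter a b c))\<^sup>2) p}"
proof -
  define D where "D = span {b - a, c - a}"
  define z where "z = closest_point D g"
  let ?q = "circumcenter a b c"
  have D: "subspace D"
    by (simp add: D_def)
  have "d - a \<in> D"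
    using d by (auto simp: D_def span_base)
  have "d \<noteq> a"
    using nc d by (auto simp: insert_commute)
  show ?thesis
  proof (cases "?q = p")
    case True
    then have "z = 0"
      using nd D by (simp add: z_def closest_point_self subspace_0)
    then show ?thesis
      by (simp add: direction_space_3 span_zero flip: D_def z_def)
  next
    case False
    have "z \<in> D" "(g - z) \<bullet> (d - a) = 0"
      using closest_point_subspace[OF D] \<open>d - a \<in> D\<close> by (simp_all add: z_def)
    then have "z \<bullet> (d - a) = 0"
      using line_along_subset_bisector(2)[OF line] by (simp add: inner_diff_left)
    moreover have "p - ?q \<in> D"
      unfolding D_def using p circumcenter_properties(1)[OF nc] by (rule affine_hull_3_diff_mem_span)
    moreover have "dist ?q a = dist ?q d"
      using d circumcenter_properties(2,3)[OF nc] by auto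
    then have "(p - ?q) \<bullet> (d - a) = 0"
      using line_along_subset_bisector(1)[OF line] by (intro equidistant_diff_orthogonal)
    ultimately have "z \<in> span {2 *\<^sub>R (p - ?q)}"
      using False \<open>z \<in> D\<close> \<open>d - a \<in> D\<close> \<open>d \<noteq> a\<close> unfolding D_def
      by (intro orthogonal_in_plane_parallel[where e = "d - a"])
        (auto intro: span_scale simp flip: scaleR_diff_right)
    then show ?thesis
      by (simp only: gradient_dist_square direction_space_3 flip: D_def z_def)
  qed
qed

text \<open>Here \<open>g\<close> is orthogonal to both generators of the direction plane. This
  settles the case where \<open>s x\<close> and \<open>\<psi> x\<close> both coincide with the
  circumcenter.\<close>

lemma projected_gradient_eq_0:
  fixes a b c p g :: "'a::euclidean_space"
  assumes "line_along p g \<subseteq> bisector a b" and "line_along p g \<subseteq> bisector a c"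
  shows "closest_point (direction_space {a, b, c} a) g = 0"
proof -
  let ?D = "span {b - a, c - a}"
  let ?z = "closest_point ?D g"
  have *: "(g - ?z) \<bullet> w = 0" if "w \<in> ?D" for w
    using closest_point_subspace(2)[OF subspace_span that] .
  have "?z \<in> ?D"
    by (simp add: closest_point_subspace(1))
  moreover have "?z \<bullet> (b - a) = 0" "?z \<bullet> (c - a) = 0"
    using *[of "b - a"] *[of "c - a"] assms[THEN line_along_subset_bisector(2)]
    by (auto simp: span_base inner_diff_left)
  ultimately show ?thesis
    unfolding direction_space_3 by (rule orthogonal_span_pair_eq_0)
qed

section \<open>Fitting conditions at a point \<open>x\<close> with a nondegenerate triangle\<close>

context
  fixes U :: "'a::euclidean_space set" and s :: "'a \<Rightarrow> 'a" and V :: "'a \<Rightarrow> real"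
    and \<Omega> \<Lambda> \<psi> :: "'a \<Rightarrow> 'a" and x :: 'a
  assumes mcs: "MCS_with U s V \<Omega> \<Lambda> \<psi>" and x: "x \<in> U"
    and nc: "\<not> collinear {x, 2 *\<^sub>R s x - x, \<Lambda> x}"
begin

lemma MCS_circumcenter: "\<Omega> x = circumcenter x (2 *\<^sub>R s x - x) (\<Lambda> x)"
  using mcs x nc by (simp add: MCS_with_def)

lemma MCS_line_s: "line_along (s x) (gradient V (s x)) \<subseteq> bisector x (2 *\<^sub>R s x - x)"
  using mcs x by (simp add: MCS_with_def)

lemma MCS_line_\<psi>: "line_along (\<psi> x) (gradient V (\<psi> x)) \<subseteq> bisector x (\<Lambda> x)"
  using mcs x by (simp add: MCS_with_def bisector_commute)

lemma MCS_projected_gradient_s: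
  assumes "\<Omega> x = s x \<Longrightarrow> gradient V (s x) = 0"
  shows "closest_point (direction_space {x, 2 *\<^sub>R s x - x, \<Lambda> x} x) (gradient V (s x))
    \<in> span {gradient (\<lambda>u. (dist u (\<Omega> x))\<^sup>2) (s x)}"
  unfolding MCS_circumcenter
proof (rule projected_gradient_mem_span[OF nc _ _ MCS_line_s])
  \<comment> \<open>\<open>s x\<close> is the midpoint of \<open>x\<close> and its reflection
    \<open>2 *\<^sub>R s x - x\<close>, hence in the plane.\<close>
  have "s x = (1/2) *\<^sub>R x + (1/2) *\<^sub>R (2 *\<^sub>R s x - x)"
    by (simp add: algebra_simps)
  also have "\<dots> \<in> affine hull {x, 2 *\<^sub>R s x - x, \<Lambda> x}"
    by (intro mem_affine[OF affine_affine_hull] hull_inc) auto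
  finally show "s x \<in> affine hull {x, 2 *\<^sub>R s x - x, \<Lambda> x}" .
qed (use assms MCS_circumcenter in auto)

lemma MCS_projected_gradient_\<psi>:
  assumes "\<Omega> x = \<psi> x \<Longrightarrow> gradient V (\<psi> x) = 0"
  shows "closest_point (direction_space {x, 2 *\<^sub>R s x - x, \<Lambda> x} x) (gradient V (\<psi> x))
    \<in> span {gradient (\<lambda>u. (dist u (\<Omega> x))\<^sup>2) (\<psi> x)}"
  unfolding MCS_circumcenter
proof (rule projected_gradient_mem_span[OF nc _ _ MCS_line_\<psi>])
  show "\<psi> x \<in> affine hull {x, 2 *\<^sub>R s x - x, \<Lambda> x}"
    using mcs x by (simp add: MCS_with_def)
qed (use assms MCS_circumcenter in auto)

end

section \<open>Membership in the class of spherical surrogates\<close>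

lemma MSS_with_2_2I:
  assumes "\<And>x j. x \<in> U \<Longrightarrow> j \<in> {1, 2} \<Longrightarrow> \<sigma> j x \<in> U"
    and "\<And>x j. x \<in> U \<Longrightarrow> j \<in> {1, 2} \<Longrightarrow> \<not> collinear {x, \<Gamma> 1 x, \<Gamma> 2 x} \<Longrightarrow>
      closest_point (direction_space {x, \<Gamma> 1 x, \<Gamma> 2 x} x) (gradient V (\<sigma> j x))
        \<in> span {gradient (\<lambda>u. (dist u (\<Theta> x))\<^sup>2) (\<sigma> j x)}"
  shows "MSS_with U V 2 2 \<Theta> \<sigma> \<Gamma>"
proof -
  have "{1..2::nat} = {1, 2}"
    by auto
  moreover have "\<not> collinear {x, \<Gamma> 1 x, \<Gamma> 2 x}"
    if "aff_dim (affine hull {x, \<Gamma> 1 x, \<Gamma> 2 x}) = int 2" for x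
    using that by (simp add: collinear_aff_dim)
  ultimately show ?thesis
    using assms unfolding MSS_with_def Let_def by (simp only: image_insert image_empty) blast
qed

lemma MCS_subset_MSS:
  assumes sU: "\<And>x. x \<in> U \<Longrightarrow> s x \<in> U"
  shows "MCS U s V \<subseteq> MSS U V 2 2"
proof
  fix \<Omega>
  assume "\<Omega> \<in> MCS U s V"
  then obtain \<Lambda> \<psi> where mcs: "MCS_with U s V \<Omega> \<Lambda> \<psi>"
    by (auto simp: MCS_def)
  \<comment> \<open>A point at the centre is replaced by the other one, at both indices. Only when
    both points are the centre does \<open>\<sigma> j x\<close> remain there.\<close>
  define \<sigma> where "\<sigma> j x = (if \<Omega> x = s x then \<psi> x
    else if \<Omega> x = \<psi> x then s x else if j = 1 then s x else \<psi> x)" for j :: nat and x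
  let ?\<Gamma> = "\<lambda>i::nat. if i = 1 then (\<lambda>x. 2 *\<^sub>R s x - x) else \<Lambda>"
  have "MSS_with U V 2 2 \<Omega> \<sigma> ?\<Gamma>"
  proof (rule MSS_with_2_2I)
    fix x and j :: nat
    assume x: "x \<in> U"
    then show "\<sigma> j x \<in> U"
      using mcs sU by (simp add: \<sigma>_def MCS_with_def)
    assume "\<not> collinear {x, ?\<Gamma> 1 x, ?\<Gamma> 2 x}"
    then have nc: "\<not> collinear {x, 2 *\<^sub>R s x - x, \<Lambda> x}"
      by simp
    note hyps = mcs x nc
    have "closest_point (direction_space {x, 2 *\<^sub>R s x - x, \<Lambda> x} x) (gradient V (\<sigma> j x))
        \<in> span {gradient (\<lambda>u. (dist u (\<Omega> x))\<^sup>2) (\<sigma> j x)}"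
    proof (cases "\<Omega> x = s x \<and> \<Omega> x = \<psi> x")
      case True
      then have "\<sigma> j x = s x" "\<psi> x = s x"
        by (auto simp: \<sigma>_def)
      \<comment> \<open>As \<open>\<psi> x = s x\<close>, one and the same gradient line lies in
        both bisectors.\<close>
      then show ?thesis
        using projected_gradient_eq_0[OF MCS_line_s[OF hyps], of "\<Lambda> x"] MCS_line_\<psi>[OF hyps]
        by (simp add: span_zero)
    next
      case False
      \<comment> \<open>The chosen point differs from the centre, so the premise of the matching
        fitting lemma holds vacuously.\<close>
      then have "\<sigma> j x = s x \<and> \<Omega> x \<noteq> s x \<or> \<sigma> j x = \<psi> x \<and> \<Omega> x \<noteq> \<psi> x"
        by (simp add: \<sigma>_def)
      then show ?thesis
        using MCS_projected_gradient_s[OF hyps] MCS_projected_gradient_\<psi>[OF hyps] by auto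
    qed
    then show "closest_point (direction_space {x, ?\<Gamma> 1 x, ?\<Gamma> 2 x} x) (gradient V (\<sigma> j x))
        \<in> span {gradient (\<lambda>u. (dist u (\<Omega> x))\<^sup>2) (\<sigma> j x)}"
      by simp
  qed
  then show "\<Omega> \<in> MSS U V 2 2"
    by (auto simp: MSS_def)
qed

text \<open>The guards concern a fitted point at the centre, where the span is zero but the
  projection of a nonzero gradient need not be. The inclusion of classes carries no guard because
  its fitted maps may be chosen anew.\<close>

theorem theorem3:
  fixes U :: "'a::euclidean_space set"
    and T :: "'a \<Rightarrow> 'a set" and s :: "'a \<Rightarrow> 'a"
    and V \<omega>1 \<omega>2 :: "'a \<Rightarrow> real"
    and \<Omega> \<Lambda> \<psi> :: "'a \<Rightarrow> 'a"
    and Q :: "'a \<Rightarrow> 'a \<Rightarrow> real"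
  assumes T_maps: "\<And>x. x \<in> U \<Longrightarrow> T x \<subseteq> U"
    and selection: "\<And>x. x \<in> U \<Longrightarrow> s x \<in> T x"
    and lyapunov: "lyapunov_function U T \<omega>1 \<omega>2 V"
    and smooth: "smooth_near U V"
    and orth: "\<And>x. x \<in> U \<Longrightarrow> inner (gradient V (s x)) (x - s x) = 0"
    and mcs: "MCS_with U s V \<Omega> \<Lambda> \<psi>"
    and Q_eq: "\<And>x u. Q x u = (dist u (\<Omega> x))\<^sup>2"
  shows "(\<forall>x\<in>U. \<not> collinear {x, 2 *\<^sub>R s x - x, \<Lambda> x} \<longrightarrow>
           ((\<Omega> x = s x \<longrightarrow> gradient V (s x) = 0) \<longrightarrow>
              closest_point (direction_space {x, 2 *\<^sub>R s x - x, \<Lambda> x} x) (gradient V (s x))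
                \<in> span {gradient (Q x) (s x)}) \<and>
           ((\<Omega> x = \<psi> x \<longrightarrow> gradient V (\<psi> x) = 0) \<longrightarrow>
              closest_point (direction_space {x, 2 *\<^sub>R s x - x, \<Lambda> x} x) (gradient V (\<psi> x))
                \<in> span {gradient (Q x) (\<psi> x)})) \<and>
    ((\<forall>x\<in>U. \<not> collinear {x, 2 *\<^sub>R s x - x, \<Lambda> x} \<longrightarrow>
         (\<Omega> x = s x \<longrightarrow> gradient V (s x) = 0) \<and> (\<Omega> x = \<psi> x \<longrightarrow> gradient V (\<psi> x) = 0)) \<longrightarrow>
       MSS_with U V 2 2 \<Omega>
         (\<lambda>j. if j = 1 then s else \<psi>)
         (\<lambda>i. if i = 1 then (\<lambda>x. 2 *\<^sub>R s x - x) else \<Lambda>)) \<and>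
    MCS U s V \<subseteq> MSS U V 2 2"
proof (intro conjI)
  have sU: "s x \<in> U" if "x \<in> U" for x
    using T_maps selection that by blast
  have Q: "Q x = (\<lambda>u. (dist u (\<Omega> x))\<^sup>2)" for x
    using Q_eq by blast
  note fit_s = MCS_projected_gradient_s[OF mcs] and fit_\<psi> = MCS_projected_gradient_\<psi>[OF mcs]
  show "\<forall>x\<in>U. \<not> collinear {x, 2 *\<^sub>R s x - x, \<Lambda> x} \<longrightarrow>
           ((\<Omega> x = s x \<longrightarrow> gradient V (s x) = 0) \<longrightarrow>
              closest_point (direction_space {x, 2 *\<^sub>R s x - x, \<Lambda> x} x) (gradient V (s x))
                \<in> span {gradient (Q x) (s x)}) \<and>
           ((\<Omega> x = \<psi> x \<longrightarrow> gradient V (\<psi> x) = 0) \<longrightarrow>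
              closest_point (direction_space {x, 2 *\<^sub>R s x - x, \<Lambda> x} x) (gradient V (\<psi> x))
                \<in> span {gradient (Q x) (\<psi> x)})"
    unfolding Q by (auto intro!: fit_s fit_\<psi>)
  show "(\<forall>x\<in>U. \<not> collinear {x, 2 *\<^sub>R s x - x, \<Lambda> x} \<longrightarrow>
         (\<Omega> x = s x \<longrightarrow> gradient V (s x) = 0) \<and> (\<Omega> x = \<psi> x \<longrightarrow> gradient V (\<psi> x) = 0)) \<longrightarrow>
       MSS_with U V 2 2 \<Omega>
         (\<lambda>j. if j = 1 then s else \<psi>)
         (\<lambda>i. if i = 1 then (\<lambda>x. 2 *\<^sub>R s x - x) else \<Lambda>)"
  proof (intro impI MSS_with_2_2I, goal_cases)
    case (1 x j)
    then show ?case
      using sU mcs by (simp add: MCS_with_def)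
  next
    case (2 x j)
    then show ?case
      using fit_s[of x] fit_\<psi>[of x] by auto
  qed
  show "MCS U s V \<subseteq> MSS U V 2 2"
    using sU by (rule MCS_subset_MSS)
qed

end
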